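(* For every nonnegative integer $n$, let $LG_2(n)$ be the number of partitions of $n$ with no part equal to $1$ in which any two consecutive parts differ by at least $2$, and by at least $4$ if both are odd. Let $T(n)$ be the number of signed partitions of $n$ with $k$ positive parts, which are even and distinct, and $t$ negative parts, which are odd, distinct and each less than $2k$, such that the smallest positive part is greater than $2t+\delta_{1u}$, where $u$ is the smallest negative part (and $\delta_{1u}=1$ if $u=1$, $\delta_{1u}=0$ otherwise, including when there are no negative parts). Then $LG_2(n)=T(n)$ for all $n\ge 0$.
   Context: A partition of an integer $n$ is a finite nonincreasing sequence of positive integers (its parts) summing to $n$. A signed partition of an integer $n$ is a pair $(\pi,\nu)$ of ordinary partitions with $|\pi|-|\nu|=n$, where $|\cdot|$ denotes the sum of parts; the parts of $\pi$ are the positive parts and the parts of $\nu$ are the negative parts (their sizes). $\delta$ is the Kronecker delta. *)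

theory Defs
  imports Main
begin

definition is_partition :: "nat list \<Rightarrow> bool" where
  "is_partition ps \<longleftrightarrow> sorted_wrt (\<ge>) ps \<and> (\<forall>p\<in>set ps. 0 < p)"

definition partition_of :: "nat \<Rightarrow> nat list \<Rightarrow> bool" where
  "partition_of n ps \<longleftrightarrow> is_partition ps \<and> sum_list ps = n"

definition signed_partition_of :: "int \<Rightarrow> nat list \<times> nat list \<Rightarrow> bool" where
  "signed_partition_of n = (\<lambda>(\<pi>, \<nu>). is_partition \<pi> \<and> is_partition \<nu> \<and>
     int (sum_list \<pi>) - int (sum_list \<nu>) = n)"

definition LG2_partitions :: "nat \<Rightarrow> nat list set" where
  "LG2_partitions n = {ps. partition_of n ps \<and> 1 \<notin> set ps \<and>
     (\<forall>i. Suc i < length ps \<longrightarrow>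
        ps ! i \<ge> ps ! Suc i + 2 \<and>
        (odd (ps ! i) \<and> odd (ps ! Suc i) \<longrightarrow> ps ! i \<ge> ps ! Suc i + 4))}"

definition LG2 :: "nat \<Rightarrow> nat" where
  "LG2 n = card (LG2_partitions n)"

definition delta_one_smallest :: "nat list \<Rightarrow> nat" where
  "delta_one_smallest \<nu> = (if \<nu> \<noteq> [] \<and> Min (set \<nu>) = 1 then 1 else 0)"

text \<open>The condition on the smallest positive part is void when there are no positive parts;
  the only such signed partition counted is the empty one, of 0.\<close>

definition T_signed_partitions :: "int \<Rightarrow> (nat list \<times> nat list) set" where
  "T_signed_partitions n = {(\<pi>, \<nu>). signed_partition_of n (\<pi>, \<nu>) \<and>
     (\<forall>p\<in>set \<pi>. even p) \<and> distinct \<pi> \<and>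
     (\<forall>q\<in>set \<nu>. odd q \<and> q < 2 * length \<pi>) \<and> distinct \<nu> \<and>
     (\<pi> \<noteq> [] \<longrightarrow> Min (set \<pi>) > 2 * length \<nu> + delta_one_smallest \<nu>)}"

definition T :: "int \<Rightarrow> nat" where
  "T n = card (T_signed_partitions n)"

end

theory Submission
  imports Defs
begin

text \<open>
  Write the parts in increasing order as \<open>p\<^sub>1 < \<dots> < p\<^sub>k\<close>. The gap condition says exactly that
  \<open>p\<^sub>i\<^sub>+\<^sub>1\<close> exceeds the even number \<open>p\<^sub>i + (p\<^sub>i mod 2)\<close> by at least 2. Each odd part \<open>p\<^sub>j\<close>
  is rounded down to an even number, then 2 is added to each of the \<open>j\<close> smallest parts, and the
  surplus is paid for by the negative part \<open>2 j - 1\<close>. The resulting positive parts are even and distinct,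
  and all exceed twice the number of negative parts. By parity the correction \<open>\<delta>\<^sub>1\<^sub>u\<close> is immaterial.
  The set of odd indices \<open>j\<close> can be read off the negative parts, so the map is a bijection.
\<close>

fun to_signed :: "nat list \<Rightarrow> nat list \<times> nat list" where
  "to_signed [] = ([], [])"
| "to_signed (p # ps) =
     ((p + p mod 2) # map (\<lambda>x. x + 2 * (p mod 2)) (fst (to_signed ps)),
      (if odd p then (2 * length ps + 1) # snd (to_signed ps) else snd (to_signed ps)))"

text \<open>The relation is transitive, so the pairwise form agrees with the condition on
  consecutive parts and passes to tails in inductions.\<close>

definition gap_partition :: "nat list \<Rightarrow> bool" where
  "gap_partition ps \<longleftrightarrow> sorted_wrt (\<lambda>a b. b + b mod 2 + 2 \<le> a) ps \<and> (\<forall>p\<in>set ps. 2 \<le> p)"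

definition admissible :: "nat list \<times> nat list \<Rightarrow> bool" where
  "admissible = (\<lambda>(\<pi>, \<nu>). sorted_wrt (>) \<pi> \<and> (\<forall>x\<in>set \<pi>. even x \<and> 2 * length \<nu> < x) \<and>
     sorted_wrt (>) \<nu> \<and> (\<forall>q\<in>set \<nu>. odd q \<and> q < 2 * length \<pi>))"

lemma length_to_signed [simp]: "length (fst (to_signed ps)) = length ps"
  by (induction ps) auto

text \<open>The value \<open>2 * length ps + 1\<close> therefore never comes from the tail: its
  presence among the negative parts records that the head is odd.\<close>

lemma negative_part_less: "q \<in> set (snd (to_signed ps)) \<Longrightarrow> q < 2 * length ps"
  by (induction ps) (auto split: if_splits)

text \<open>An odd head gains 1 and each of the \<open>length ps\<close> smaller parts gains 2,
  which is exactly the new negative part.\<close>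

lemma sum_to_signed:
  "sum_list (fst (to_signed ps)) = sum_list ps + sum_list (snd (to_signed ps))"
proof (induction ps)
  case (Cons p ps)
  have "sum_list (map (\<lambda>x. x + 2 * (p mod 2)) xs) = sum_list xs + 2 * (p mod 2) * length xs" for xs
    by (induction xs) auto
  with Cons show ?case by (auto simp: odd_iff_mod_2_eq_one)
qed simp

text \<open>The negative parts reveal the parity of the head; this determines the head itself and
  the shift to undo on the tail.\<close>

lemma inj_to_signed: "inj to_signed"
proof -
  have "to_signed ps = to_signed qs \<Longrightarrow> ps = qs" for ps qs
  proof (induction ps arbitrary: qs)
    case Nil
    then show ?case by (cases qs) auto
  next
    case (Cons p ps)
    then obtain q qs' where qs: "qs = q # qs'" by (cases qs) auto
    have len: "length ps = length qs'"
      using Cons.prems qs length_to_signed by (metis length_Cons nat.inject)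
    have odd_iff: "odd r \<longleftrightarrow> 2 * length rs + 1 \<in> set (snd (to_signed (r # rs)))" for r rs
      using negative_part_less[of "2 * length rs + 1" rs] by auto
    have par: "odd p \<longleftrightarrow> odd q"
      using odd_iff[of p ps] odd_iff[of q qs'] Cons.prems qs len by simp
    have m: "p mod 2 = q mod 2" using par by presburger
    have "p = q" using Cons.prems qs m by simp
    moreover have "fst (to_signed ps) = fst (to_signed qs')"
    proof -
      have "inj (\<lambda>x::nat. x + 2 * (q mod 2))" by (simp add: inj_def)
      moreover have "map (\<lambda>x. x + 2 * (q mod 2)) (fst (to_signed ps)) =
        map (\<lambda>x. x + 2 * (q mod 2)) (fst (to_signed qs'))"
        using Cons.prems qs m by simp
      ultimately show ?thesis by (simp only: inj_map_eq_map)
    qed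
    moreover have "snd (to_signed ps) = snd (to_signed qs')"
      using Cons.prems qs par by (auto split: if_splits)
    ultimately show ?case using Cons.IH qs by (metis prod_eq_iff)
  qed
  then show ?thesis by (simp add: inj_def)
qed

lemma admissible_to_signed: "gap_partition ps \<Longrightarrow> admissible (to_signed ps)"
proof (induction ps)
  case Nil
  then show ?case by (simp add: admissible_def)
next
  case (Cons p ps)
  let ?o = "p mod 2"
  obtain \<pi> \<nu> where eq: "to_signed ps = (\<pi>, \<nu>)" by fastforce
  have adm: "admissible (\<pi>, \<nu>)"
    using Cons eq by (simp add: gap_partition_def)
  have len: "length \<pi> = length ps" using length_to_signed[of ps] eq by simp
  have p2: "2 \<le> p" using Cons.prems by (simp add: gap_partition_def)
  have o_le: "?o \<le> 1" by simp
  \<comment> \<open>The largest element of \<open>\<pi>\<close> is the rounded head of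
    \<open>ps\<close>; the gap of 2 above it absorbs the shift \<open>2 * ?o\<close>, since
    \<open>?o \<le> 1\<close>.\<close>
  have first: "x + 2 * ?o < p + ?o" if "x \<in> set \<pi>" for x
  proof (cases ps)
    case Nil
    then show ?thesis using that eq by simp
  next
    case (Cons y ys)
    then obtain xs where \<pi>: "\<pi> = (y + y mod 2) # xs" using eq by auto
    have "x \<le> y + y mod 2" using adm that \<pi> by (auto simp: admissible_def)
    moreover have "y + y mod 2 + 2 \<le> p"
      using Cons.prems Cons by (simp add: gap_partition_def)
    ultimately show ?thesis using o_le by linarith
  qed
  \<comment> \<open>The new list of negative parts has length \<open>length \<nu> + ?o\<close>. For
    a nonempty tail the bound passes from the head of \<open>\<pi>\<close> to \<open>p\<close>; for
    an empty one it rests on \<open>2 \<le> p\<close>, as \<open>p = 1\<close> would fail.\<close>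
  have small: "2 * length \<nu> + 2 * ?o < p + ?o"
  proof (cases ps)
    case Nil
    then show ?thesis using eq p2 o_le by simp
  next
    case (Cons y ys)
    then have mem: "y + y mod 2 \<in> set \<pi>" using eq by auto
    then have "2 * length \<nu> < y + y mod 2" using adm by (auto simp: admissible_def)
    with first[OF mem] show ?thesis by linarith
  qed
  show ?case
  proof (cases "odd p")
    case True
    then have "?o = 1" by presburger
    with True adm eq len first small show ?thesis
      by (auto simp: admissible_def sorted_wrt_map intro: less_SucI)
  next
    case False
    then have "?o = 0" by presburger
    with False adm eq len first small show ?thesis
      by (auto simp: admissible_def intro: less_SucI)
  qed
qed

text \<open>One step of the recursion is undone according to whether the largest admissible negative
  part \<open>2 * length xs + 1\<close> occurs. Induction is on the length because the tail may have
  to be lowered by 2 first.\<close>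

lemma to_signed_surj:
  "admissible (\<pi>, \<nu>) \<Longrightarrow> \<exists>ps. gap_partition ps \<and> to_signed ps = (\<pi>, \<nu>)"
proof (induction \<pi> arbitrary: \<nu> rule: length_induct)
  case (1 \<pi>)
  show ?case
  proof (cases \<pi>)
    case Nil
    with 1 have "to_signed [] = (\<pi>, \<nu>)" by (cases \<nu>) (auto simp: admissible_def)
    moreover have "gap_partition []" by (simp add: gap_partition_def)
    ultimately show ?thesis by blast
  next
    case (Cons x xs)
    \<comment> \<open>The rounded head of \<open>ps\<close> is itself an element of
      \<open>ys\<close>, so a bound on \<open>ys\<close> yields the gap between \<open>p\<close> and
      its successor.\<close>
    have extend: "gap_partition (p # ps)"
      if ps: "gap_partition ps" "to_signed ps = (ys, \<mu>)"
        and "2 \<le> p" and le: "\<And>y. y \<in> set ys \<Longrightarrow> y + 2 \<le> p" for p ps ys \<mu>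
    proof (cases ps)
      case Nil
      then show ?thesis using that by (simp add: gap_partition_def)
    next
      case (Cons z zs)
      have "z + z mod 2 \<in> set ys" using ps Cons by auto
      then have "z + z mod 2 + 2 \<le> p" by (rule le)
      then show ?thesis using ps Cons \<open>2 \<le> p\<close>
        by (fastforce simp: gap_partition_def)
    qed
    have ev: "even x" and xs_ev: "\<And>y. y \<in> set xs \<Longrightarrow> even y \<and> y < x \<and> 2 * length \<nu> < y"
      and x_gt: "2 * length \<nu> < x" and xs_sorted: "sorted_wrt (>) xs"
      and \<nu>_sorted: "sorted_wrt (>) \<nu>"
      and \<nu>_odd: "\<And>q. q \<in> set \<nu> \<Longrightarrow> odd q \<and> q < 2 * length xs + 2"
      using "1.prems" Cons by (auto simp: admissible_def)
    show ?thesis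
    proof (cases "2 * length xs + 1 \<in> set \<nu>")
      case True
      obtain h \<mu> where \<nu>: "\<nu> = h # \<mu>" using True by (cases \<nu>) auto
      have h: "h = 2 * length xs + 1"
        using True \<nu> \<nu>_sorted \<nu>_odd[of h] by auto
      \<comment> \<open>No truncation occurs: \<open>\<nu>\<close> is nonempty, so every element of
        \<open>xs\<close> exceeds 2.\<close>
      define ys where "ys = map (\<lambda>y. y - 2) xs"
      have xs: "xs = map (\<lambda>y. y + 2) ys"
        unfolding ys_def using xs_ev \<nu> by (force simp: comp_def intro!: map_idI[symmetric])
      have "q < 2 * length ys" if "q \<in> set \<mu>" for q
      proof -
        \<comment> \<open>This gives only \<open>q \<le> 2 * length ys\<close>; oddness of
          \<open>q\<close> excludes equality.\<close>
        have "q < h" using that \<nu> \<nu>_sorted by auto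
        moreover have "odd q" using that \<nu> \<nu>_odd by auto
        ultimately show ?thesis using h by (auto simp: ys_def less_Suc_eq)
      qed
      moreover have "even y \<and> 2 * length \<mu> < y" if "y \<in> set ys" for y
        using xs_ev[of "y + 2"] that xs \<nu> by auto
      moreover have "sorted_wrt (>) ys"
        using xs_sorted by (simp add: xs sorted_wrt_map)
      ultimately have "admissible (ys, \<mu>)"
        using \<nu>_sorted \<nu>_odd \<nu> unfolding admissible_def by auto
      moreover have "length ys < length \<pi>" using Cons by (simp add: ys_def)
      ultimately obtain ps where ps: "gap_partition ps" "to_signed ps = (ys, \<mu>)"
        using "1.IH" by blast
      have len: "length ps = length xs" using length_to_signed[of ps] ps by (simp add: ys_def)
      \<comment> \<open>The head \<open>x\<close> arose by rounding up an odd part, hence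
        \<open>x - 1\<close>.\<close>
      have "gap_partition ((x - 1) # ps)"
      proof (rule extend[OF ps])
        show "2 \<le> x - 1" using x_gt \<nu> by simp
        show "y + 2 \<le> x - 1" if "y \<in> set ys" for y
          using xs_ev[of "y + 2"] that xs by auto
      qed
      moreover have "odd (x - 1)" "(x - 1) mod 2 = 1" "x - 1 + 1 = x"
        using ev x_gt by presburger+
      then have "to_signed ((x - 1) # ps) = (\<pi>, \<nu>)"
        using ps Cons \<nu> h len xs by simp
      ultimately show ?thesis by blast
    next
      case False
      have "q < 2 * length xs" if "q \<in> set \<nu>" for q
      proof -
        have "q \<noteq> 2 * length xs + 1" using False that by blast
        then show ?thesis using \<nu>_odd[OF that] by presburger
      qed
      then have "admissible (xs, \<nu>)"
        using xs_ev xs_sorted \<nu>_sorted \<nu>_odd unfolding admissible_def by auto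
      moreover have "length xs < length \<pi>" using Cons by simp
      ultimately obtain ps where ps: "gap_partition ps" "to_signed ps = (xs, \<nu>)"
        using "1.IH" by blast
      have "gap_partition (x # ps)"
      proof (rule extend[OF ps])
        show "2 \<le> x" using x_gt ev by presburger
        show "y + 2 \<le> x" if "y \<in> set xs" for y
          using xs_ev[OF that] ev by presburger
      qed
      moreover have "to_signed (x # ps) = (\<pi>, \<nu>)"
        using ps Cons ev by simp
      ultimately show ?thesis by blast
    qed
  qed
qed

lemma LG2_partitions_eq: "LG2_partitions n = {ps. gap_partition ps \<and> sum_list ps = n}"
proof -
  \<comment> \<open>For odd \<open>b\<close>, parity turns the bound \<open>b + 2\<close> (even
    \<open>a\<close>) and the bound \<open>b + 4\<close> (odd \<open>a\<close>) both into
    \<open>b + 3\<close>.\<close>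
  have gap_iff: "(b + 2 \<le> a \<and> (odd a \<and> odd b \<longrightarrow> b + 4 \<le> a)) \<longleftrightarrow> b + b mod 2 + 2 \<le> a"
    for a b :: nat by presburger
  have tr: "transp (\<lambda>a b::nat. b + b mod 2 + 2 \<le> a)" by (rule transpI) linarith
  have ge2: "(\<forall>p\<in>set ps. 2 \<le> p) \<longleftrightarrow> (\<forall>p\<in>set ps. 0 < p) \<and> 1 \<notin> set ps" for ps :: "nat list"
  proof -
    have "2 \<le> p \<longleftrightarrow> 0 < p \<and> p \<noteq> 1" for p :: nat by linarith
    then show ?thesis by auto
  qed
  have sorted: "sorted_wrt (\<lambda>a b. b + b mod 2 + 2 \<le> a) ps \<longleftrightarrow>
      (\<forall>i. Suc i < length ps \<longrightarrow> ps ! Suc i + ps ! Suc i mod 2 + 2 \<le> ps ! i)" for ps :: "nat list"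
    by (rule sorted_wrt_iff_nth_Suc_transp[OF tr])
  have ge: "sorted_wrt (\<lambda>a b. b + b mod 2 + 2 \<le> a) ps \<Longrightarrow> sorted_wrt (\<ge>) ps" for ps :: "nat list"
    by (erule sorted_wrt_mono_rel[rotated]) simp
  show ?thesis
    unfolding LG2_partitions_def partition_of_def is_partition_def gap_partition_def gap_iff
      sorted[symmetric] ge2
    using ge by blast
qed

lemma T_signed_partitions_eq:
  "T_signed_partitions n =
     {(\<pi>, \<nu>). admissible (\<pi>, \<nu>) \<and> int (sum_list \<pi>) - int (sum_list \<nu>) = n}"
proof -
  have strict: "sorted_wrt (\<ge>) xs \<and> distinct xs \<longleftrightarrow> sorted_wrt (>) xs" for xs :: "nat list"
    by (induction xs) (auto simp: le_less)
  have min_iff: "(xs \<noteq> [] \<longrightarrow> 2 * length \<nu> + delta_one_smallest \<nu> < Min (set xs)) \<longleftrightarrow>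
      (\<forall>x\<in>set xs. 2 * length \<nu> < x)" if ev: "\<forall>x\<in>set xs. even x" for xs \<nu> :: "nat list"
  proof -
    have "2 * length \<nu> + delta_one_smallest \<nu> < x \<longleftrightarrow> 2 * length \<nu> < x" if "x \<in> set xs" for x
    proof -
      have "even x" using ev that by blast
      \<comment> \<open>An even number above the even number \<open>2 * length \<nu>\<close> exceeds
        it by at least 2, which leaves room for a correction of 0 or 1.\<close>
      then have "2 * length \<nu> + 1 < x" if "2 * length \<nu> < x" using that by presburger
      then show ?thesis unfolding delta_one_smallest_def by auto
    qed
    then show ?thesis by (cases "xs = []") auto
  qed
  have "(\<pi>, \<nu>) \<in> T_signed_partitions n \<longleftrightarrow>
      admissible (\<pi>, \<nu>) \<and> int (sum_list \<pi>) - int (sum_list \<nu>) = n" for \<pi> \<nu>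
    unfolding T_signed_partitions_def signed_partition_of_def is_partition_def admissible_def
    using strict[of \<pi>] strict[of \<nu>] min_iff[of \<pi> \<nu>] by (auto intro: odd_pos)
  then show ?thesis by auto
qed

theorem theorem5p2:
  fixes n :: nat
  shows "LG2 n = T (int n)"
proof -
  have "to_signed ` LG2_partitions n = T_signed_partitions (int n)"
  proof (intro set_eqI iffI)
    fix s assume "s \<in> to_signed ` LG2_partitions n"
    then show "s \<in> T_signed_partitions (int n)"
      using admissible_to_signed sum_to_signed
      by (fastforce simp: LG2_partitions_eq T_signed_partitions_eq case_prod_beta)
  next
    fix s assume s: "s \<in> T_signed_partitions (int n)"
    then obtain ps where "gap_partition ps" "to_signed ps = s"
      using to_signed_surj by (auto simp: T_signed_partitions_eq)
    with s show "s \<in> to_signed ` LG2_partitions n"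
      using sum_to_signed[of ps] by (auto simp: LG2_partitions_eq T_signed_partitions_eq)
  qed
  then show ?thesis
    unfolding LG2_def T_def using card_image inj_to_signed by (metis inj_on_subset subset_UNIV)
qed

end
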